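(* Let $G=\langle V,E\rangle$ be a connected chordal graph and let $S,T$ be distinct vertices of $G$. There exists a non-separating path from $S$ to $T$ if and only if $S$ and $T$ are not separated by a bridge (i.e. there is no bridge $e$ such that $S$ and $T$ lie in different connected components of $G$ with $e$ removed). Moreover, when such a path exists, a path from $S$ to $T$ containing the minimum number of edges is a non-separating path.
   Context: A chordal graph is a simple undirected graph in which every cycle with four or more vertices has a chord. A bridge is an edge whose removal disconnects $G$. A path is a sequence of vertices with consecutive vertices adjacent. A path $p$ is non-separating if the graph obtained from $G$ by deleting all edges lying on $p$ is still connected. *)

theory Defs
  imports Main
begin

text \<open>
  A graph is given by its vertex set \<open>V\<close> and its set \<open>E\<close> of edges, each edge being the two-element
  set of its end points. No finiteness is required.
\<close>

definition simple_graph :: "'a set \<Rightarrow> 'a set set \<Rightarrow> bool" where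
  "simple_graph V E \<longleftrightarrow> (\<forall>e\<in>E. \<exists>u\<in>V. \<exists>v\<in>V. u \<noteq> v \<and> e = {u, v})"

text \<open>Vertices and edges may be repeated along a path; a single vertex is a path without edges.\<close>

definition is_path :: "'a set \<Rightarrow> 'a set set \<Rightarrow> 'a list \<Rightarrow> bool" where
  "is_path V E p \<longleftrightarrow> p \<noteq> [] \<and> set p \<subseteq> V \<and> successively (\<lambda>u v. {u, v} \<in> E) p"

definition path_between :: "'a set \<Rightarrow> 'a set set \<Rightarrow> 'a \<Rightarrow> 'a \<Rightarrow> 'a list \<Rightarrow> bool" where
  "path_between V E s t p \<longleftrightarrow> is_path V E p \<and> hd p = s \<and> last p = t"

definition path_edges :: "'a list \<Rightarrow> 'a set set" where
  "path_edges p = {{p ! i, p ! Suc i} | i. Suc i < length p}"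

definition num_edges :: "'a list \<Rightarrow> nat" where
  "num_edges p = length p - 1"

definition component :: "'a set \<Rightarrow> 'a set set \<Rightarrow> 'a \<Rightarrow> 'a set" where
  "component V E v = {w. \<exists>p. path_between V E v w p}"

definition graph_connected :: "'a set \<Rightarrow> 'a set set \<Rightarrow> bool" where
  "graph_connected V E \<longleftrightarrow> (\<forall>u\<in>V. \<forall>v\<in>V. \<exists>p. path_between V E u v p)"

text \<open>A cycle is listed without repeating its first vertex at the end.\<close>

definition is_cycle :: "'a set \<Rightarrow> 'a set set \<Rightarrow> 'a list \<Rightarrow> bool" where
  "is_cycle V E c \<longleftrightarrow> 3 \<le> length c \<and> distinct c \<and> is_path V E c \<and> {last c, hd c} \<in> E"

definition cycle_edges :: "'a list \<Rightarrow> 'a set set" where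
  "cycle_edges c = insert {last c, hd c} (path_edges c)"

definition is_chord :: "'a set set \<Rightarrow> 'a list \<Rightarrow> 'a set \<Rightarrow> bool" where
  "is_chord E c e \<longleftrightarrow> e \<in> E \<and> e \<subseteq> set c \<and> e \<notin> cycle_edges c"

definition chordal_graph :: "'a set \<Rightarrow> 'a set set \<Rightarrow> bool" where
  "chordal_graph V E \<longleftrightarrow>
     simple_graph V E \<and> (\<forall>c. is_cycle V E c \<and> 4 \<le> length c \<longrightarrow> (\<exists>e. is_chord E c e))"

definition is_bridge :: "'a set \<Rightarrow> 'a set set \<Rightarrow> 'a set \<Rightarrow> bool" where
  "is_bridge V E e \<longleftrightarrow> e \<in> E \<and> \<not> graph_connected V (E - {e})"

definition separated_by_bridge :: "'a set \<Rightarrow> 'a set set \<Rightarrow> 'a \<Rightarrow> 'a \<Rightarrow> bool" where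
  "separated_by_bridge V E s t \<longleftrightarrow>
     (\<exists>e. is_bridge V E e \<and> component V (E - {e}) s \<noteq> component V (E - {e}) t)"

definition nonseparating_path :: "'a set \<Rightarrow> 'a set set \<Rightarrow> 'a \<Rightarrow> 'a \<Rightarrow> 'a list \<Rightarrow> bool" where
  "nonseparating_path V E s t p \<longleftrightarrow>
     path_between V E s t p \<and> graph_connected V (E - path_edges p)"

definition shortest_path :: "'a set \<Rightarrow> 'a set set \<Rightarrow> 'a \<Rightarrow> 'a \<Rightarrow> 'a list \<Rightarrow> bool" where
  "shortest_path V E s t p \<longleftrightarrow>
     path_between V E s t p \<and> (\<forall>q. path_between V E s t q \<longrightarrow> num_edges p \<le> num_edges q)"

end

theory Submission
  imports Defs
begin

text \<open>
  Every edge on a shortest path between vertices that no bridge separates is itself not a bridge,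
  so it lies on a cycle; in a chordal graph a shortest such cycle is a triangle. The third vertex of
  the triangle cannot lie on the path, as that would allow a shortcut, so the edge can be replaced
  by the two other sides of the triangle without using any edge of the path.
\<close>

section \<open>Paths, reachability and connectedness\<close>

definition adjacent :: "'a set \<Rightarrow> 'a set set \<Rightarrow> 'a \<Rightarrow> 'a \<Rightarrow> bool" where
  "adjacent V E u v \<longleftrightarrow> u \<in> V \<and> v \<in> V \<and> {u, v} \<in> E"

lemma reachable_sym: "(adjacent V E)\<^sup>*\<^sup>* u v \<Longrightarrow> (adjacent V E)\<^sup>*\<^sup>* v u"
  by (rule sympD[OF symp_rtranclp]) (auto simp: symp_def adjacent_def insert_commute)

lemma path_imp_reachable:
  "is_path V E p \<Longrightarrow> hd p \<in> V \<and> (adjacent V E)\<^sup>*\<^sup>* (hd p) (last p)"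
proof (induction p)
  case (Cons a p)
  show ?case
  proof (cases p)
    case (Cons b q)
    with Cons.prems have "adjacent V E a b" "is_path V E p"
      by (auto simp: is_path_def adjacent_def)
    moreover from this Cons.IH Cons have "(adjacent V E)\<^sup>*\<^sup>* b (last p)" by simp
    moreover have "a \<in> V" using Cons.prems by (simp add: is_path_def)
    ultimately show ?thesis using Cons by (simp add: converse_rtranclp_into_rtranclp)
  qed (use Cons.prems in \<open>auto simp: is_path_def\<close>)
qed (simp add: is_path_def)

lemma reachable_imp_path:
  assumes "(adjacent V E)\<^sup>*\<^sup>* u v" and "u \<in> V"
  shows "\<exists>p. path_between V E u v p"
  using assms
proof (induction rule: converse_rtranclp_induct)
  case base
  then have "path_between V E v v [v]" by (simp add: path_between_def is_path_def)
  then show ?case ..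
next
  case (step u w)
  then obtain p where "path_between V E w v p" by (auto simp: adjacent_def)
  with step.hyps have "path_between V E u v (u # p)"
    by (auto simp: path_between_def is_path_def adjacent_def successively_Cons)
  then show ?case ..
qed

text \<open>The closure relates every element to itself, even outside \<open>V\<close>, while a path
  stays in \<open>V\<close>; hence the condition on \<open>u\<close>. Since \<open>adjacent\<close>
  keeps both ends in \<open>V\<close>, nothing is needed for \<open>v\<close>.\<close>

lemma ex_path_iff_reachable:
  "(\<exists>p. path_between V E u v p) \<longleftrightarrow> u \<in> V \<and> (adjacent V E)\<^sup>*\<^sup>* u v"
  using path_imp_reachable reachable_imp_path by (metis path_between_def)

lemma graph_connected_iff:
  "graph_connected V E \<longleftrightarrow> (\<forall>u\<in>V. \<forall>v\<in>V. (adjacent V E)\<^sup>*\<^sup>* u v)"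
  by (auto simp: graph_connected_def ex_path_iff_reachable)

lemma component_eq: "v \<in> V \<Longrightarrow> component V E v = {w. (adjacent V E)\<^sup>*\<^sup>* v w}"
  by (simp add: component_def ex_path_iff_reachable)

text \<open>Rerouting a walk edge by edge. For \<open>F\<close> obtained from \<open>E\<close> by
  deleting edges, only the deleted edges need a real detour.\<close>

lemma graph_connected_replace:
  assumes "graph_connected V E"
    and "\<And>u v. adjacent V E u v \<Longrightarrow> (adjacent V F)\<^sup>*\<^sup>* u v"
  shows "graph_connected V F"
proof -
  have "(adjacent V F)\<^sup>*\<^sup>* u v" if "(adjacent V E)\<^sup>*\<^sup>* u v" for u v
    using that by induction (blast, metis assms(2) rtranclp_trans)
  then show ?thesis using assms(1) by (simp add: graph_connected_iff)
qed

lemma graph_connected_mono: "graph_connected V E \<Longrightarrow> E \<subseteq> F \<Longrightarrow> graph_connected V F"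
  by (erule graph_connected_replace) (rule r_into_rtranclp, auto simp: adjacent_def)

section \<open>Cutting and joining paths\<close>

lemma is_path_nth:
  "is_path V E p \<longleftrightarrow> p \<noteq> [] \<and> set p \<subseteq> V \<and> (\<forall>i. Suc i < length p \<longrightarrow> {p ! i, p ! Suc i} \<in> E)"
  by (auto simp: is_path_def successively_conv_nth)

lemma is_path_restrict: "is_path V E p \<Longrightarrow> path_edges p \<subseteq> F \<Longrightarrow> is_path V F p"
  unfolding is_path_nth path_edges_def by blast

lemma path_edges_subset: "is_path V E p \<Longrightarrow> path_edges p \<subseteq> E"
  unfolding is_path_nth path_edges_def by blast

lemma is_path_mono: "is_path V E p \<Longrightarrow> E \<subseteq> F \<Longrightarrow> is_path V F p"
  unfolding is_path_nth by blast

lemma is_path_take: "is_path V E p \<Longrightarrow> 0 < n \<Longrightarrow> is_path V E (take n p)"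
  by (auto simp: is_path_nth dest: in_set_takeD)

lemma is_path_drop: "is_path V E p \<Longrightarrow> n < length p \<Longrightarrow> is_path V E (drop n p)"
  by (auto simp: is_path_nth dest: in_set_dropD)

lemma is_path_append:
  "is_path V E p \<Longrightarrow> is_path V E q \<Longrightarrow> {last p, hd q} \<in> E \<Longrightarrow> is_path V E (p @ q)"
  by (auto simp: is_path_def successively_append_iff)

lemma last_take_Suc: "i < length p \<Longrightarrow> last (take (Suc i) p) = p ! i"
  by (simp add: take_Suc_conv_app_nth)

section \<open>Shortest paths, and triangles in chordal graphs\<close>

lemma ex_shortest_path:
  assumes "path_between V E s t p"
  shows "\<exists>q. shortest_path V E s t q"
  \<comment> \<open>Edge counts are natural numbers, so a minimum is attained even in an infinite
    graph.\<close>
  using ex_has_least_nat[of "path_between V E s t", OF assms, of num_edges]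
  by (auto simp: shortest_path_def)

lemma shortest_path_no_shortcut:
  assumes "shortest_path V E s t p" and "Suc i < j" and "j < length p"
  shows "{p ! i, p ! j} \<notin> E"
proof
  assume edge: "{p ! i, p ! j} \<in> E"
  have p: "is_path V E p" "hd p = s" "last p = t"
    using assms(1) by (auto simp: shortest_path_def path_between_def)
  \<comment> \<open>The edge from \<open>p ! i\<close> to \<open>p ! j\<close> bypasses the
    positions strictly between; there is at least one, because \<open>Suc i < j\<close>.\<close>
  let ?q = "take (Suc i) p @ drop j p"
  have "is_path V E ?q"
    using p(1) assms edge
    by (intro is_path_append is_path_take is_path_drop) (auto simp: last_take_Suc hd_drop_conv_nth)
  then have "path_between V E s t ?q"
    using p assms by (auto simp: path_between_def is_path_def hd_append)
  then have "num_edges p \<le> num_edges ?q" using assms(1) by (simp add: shortest_path_def)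
  then show False using assms by (simp add: num_edges_def)
qed

lemma shortest_path_distinct:
  assumes "shortest_path V E s t p"
  shows "distinct p"
proof (rule ccontr)
  have p: "is_path V E p" "hd p = s" "last p = t"
    using assms by (auto simp: shortest_path_def path_between_def)
  assume "\<not> distinct p"
  then obtain i j where ij: "i < j" "j < length p" "p ! i = p ! j"
    by (auto simp: distinct_conv_nth) (metis linorder_neqE_nat)
  \<comment> \<open>Cut out the closed walk between the two occurrences, keeping the repeated vertex
    once, at position \<open>j\<close>.\<close>
  let ?q = "take i p @ drop j p"
  have "is_path V E ?q"
  proof (cases i)
    \<comment> \<open>The initial piece is empty, hence not a path, so \<open>is_path_append\<close>
      does not apply; the final piece alone is the new path.\<close>
    case 0
    then show ?thesis using ij p by (simp add: is_path_drop)
  next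
    case (Suc k)
    have "{p ! k, p ! Suc k} \<in> E" using p(1) ij(1,2) Suc by (simp add: is_path_nth)
    then have "{p ! k, p ! j} \<in> E" using ij Suc by simp
    then show ?thesis using ij p(1) Suc
      by (intro is_path_append is_path_take is_path_drop)
        (auto simp: last_take_Suc hd_drop_conv_nth)
  qed
  moreover have "hd ?q = s"
    using ij p(1,2) by (cases i) (auto simp: hd_drop_conv_nth hd_append hd_conv_nth is_path_def)
  ultimately have "path_between V E s t ?q"
    using p ij by (simp add: path_between_def)
  then have "num_edges p \<le> num_edges ?q" using assms by (simp add: shortest_path_def)
  then show False using ij by (simp add: num_edges_def)
qed

text \<open>A shortest detour from \<open>u\<close> to \<open>v\<close> avoiding the edge
  \<open>{u, v}\<close>, closed up by that edge, is a cycle. On four or more vertices it would have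
  a chord, and this chord would shorten the detour. So the detour has exactly one inner vertex, the
  apex of the triangle.\<close>

lemma chordal_edge_in_triangle:
  assumes "chordal_graph V E" and "{u, v} \<in> E" and "u \<noteq> v"
    and "path_between V (E - {{u, v}}) u v p"
  shows "\<exists>w\<in>V. w \<noteq> u \<and> w \<noteq> v \<and> {u, w} \<in> E \<and> {w, v} \<in> E"
proof -
  obtain q where q: "shortest_path V (E - {{u, v}}) u v q"
    using ex_shortest_path[OF assms(4)] by blast
  have d: "distinct q" using q by (rule shortest_path_distinct)
  have path: "is_path V (E - {{u, v}}) q" and ends: "hd q = u" "last q = v"
    using q by (auto simp: shortest_path_def path_between_def)
  have ne: "q \<noteq> []" using path by (simp add: is_path_def)
  have ends': "q ! 0 = u" "q ! (length q - 1) = v"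
    using ends ne by (auto simp: hd_conv_nth last_conv_nth)
  have edges: "{q ! i, q ! Suc i} \<in> E - {{u, v}}" if "Suc i < length q" for i
    using path that by (simp add: is_path_nth)
  have "length q \<noteq> 1" using ends' assms(3) by auto
  \<comment> \<open>Two vertices would make the detour the deleted edge itself.\<close>
  moreover have "length q \<noteq> 2" using ends' edges[of 0] by auto
  ultimately have len: "3 \<le> length q" using length_greater_0_conv[of q] ne by linarith
  have "is_cycle V E q"
    using len d ends assms(2) is_path_mono[OF path] by (auto simp: is_cycle_def insert_commute)
  have len3: "length q = 3"
  proof (rule ccontr)
    assume "length q \<noteq> 3"
    then obtain e where e: "is_chord E q e"
      using len assms(1) \<open>is_cycle V E q\<close> by (auto simp: chordal_graph_def)
    then obtain x y where xy: "e = {x, y}" "x \<noteq> y"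
      using assms(1) by (auto simp: chordal_graph_def simple_graph_def is_chord_def)
    then have "x \<in> set q" "y \<in> set q" using e by (auto simp: is_chord_def)
    then obtain a b where ab: "a < length q" "b < length q" "x = q ! a" "y = q ! b"
      by (metis in_set_conv_nth)
    obtain i j where ij: "i < j" "j < length q" "e = {q ! i, q ! j}"
      using xy ab by (metis insert_commute linorder_neqE_nat)
    \<comment> \<open>The closing edge of the cycle is \<open>{u, v}\<close>, so a chord differs
      from it and survives its deletion: it can serve as a shortcut for \<open>q\<close>.\<close>
    have "e \<noteq> {u, v}" "e \<notin> path_edges q" "e \<in> E"
      using e ends by (auto simp: is_chord_def cycle_edges_def insert_commute)
    then have "Suc i \<noteq> j" using ij by (auto simp: path_edges_def)
    then have "Suc i < j" using ij by simp
    then have "e \<notin> E - {{u, v}}" using shortest_path_no_shortcut[OF q] ij by blast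
    then show False using \<open>e \<in> E\<close> \<open>e \<noteq> {u, v}\<close> by simp
  qed
  then have end2: "q ! Suc 1 = v" using ends' by (simp add: numeral_2_eq_2)
  have "q ! 1 \<in> V" using path len by (auto simp: is_path_def)
  moreover have "q ! 1 \<noteq> u" "q ! 1 \<noteq> v"
    using nth_eq_iff_index_eq[OF d, of 1 0] nth_eq_iff_index_eq[OF d, of 1 "Suc 1"] len3 ends'(1) end2
    by simp_all
  moreover have "{u, q ! 1} \<in> E" "{q ! 1, v} \<in> E"
    using edges[of 0] edges[of 1] ends'(1) end2 len3 by simp_all
  ultimately show ?thesis by blast
qed

section \<open>Bridges and non-separating paths\<close>

lemma nonseparating_imp_not_separated:
  assumes "S \<in> V" "T \<in> V" and p: "nonseparating_path V E S T p"
  shows "\<not> separated_by_bridge V E S T"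
proof
  assume "separated_by_bridge V E S T"
  then obtain e where e: "is_bridge V E e" "component V (E - {e}) S \<noteq> component V (E - {e}) T"
    by (auto simp: separated_by_bridge_def)
  have path: "is_path V E p" "hd p = S" "last p = T"
    using p by (auto simp: nonseparating_path_def path_between_def)
  show False
  proof (cases "e \<in> path_edges p")
    case True
    \<comment> \<open>Deleting all path edges keeps the graph connected, so deleting just
      \<open>e\<close> does too.\<close>
    then have "graph_connected V (E - {e})"
      using p by (auto simp: nonseparating_path_def elim: graph_connected_mono)
    then show False using e by (simp add: is_bridge_def)
  next
    case False
    \<comment> \<open>The path avoids \<open>e\<close>, so it still joins \<open>S\<close> to
      \<open>T\<close> once the bridge is gone.\<close>
    then have "is_path V (E - {e}) p"
      using path path_edges_subset[OF path(1)] by (intro is_path_restrict[OF path(1)]) auto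
    then have "(adjacent V (E - {e}))\<^sup>*\<^sup>* S T" using path_imp_reachable path by metis
    then have "component V (E - {e}) S = component V (E - {e}) T"
      using assms(1,2) by (simp add: component_eq) (metis reachable_sym rtranclp_trans)
    then show False using e by simp
  qed
qed

text \<open>If the edge were a bridge, \<open>S\<close> and \<open>T\<close> would still be joined
  without it. Following \<open>p\<close> back from \<open>p ! i\<close> to \<open>S\<close>, then
  that connection to \<open>T\<close>, then \<open>p\<close> back to \<open>p ! Suc i\<close> goes
  around the edge, so its deletion disconnects nothing.\<close>

lemma shortest_path_edge_not_bridge:
  assumes "graph_connected V E" and "S \<in> V" and "T \<in> V"
    and p: "shortest_path V E S T p"
    and nsep: "\<not> separated_by_bridge V E S T"
    and i: "Suc i < length p"
  shows "graph_connected V (E - {{p ! i, p ! Suc i}})"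
proof (rule ccontr)
  let ?e = "{p ! i, p ! Suc i}"
  let ?R = "(adjacent V (E - {?e}))\<^sup>*\<^sup>*"
  assume nc: "\<not> graph_connected V (E - {?e})"
  have path: "is_path V E p" "hd p = S" "last p = T"
    using p by (auto simp: shortest_path_def path_between_def)
  have d: "distinct p" using p by (rule shortest_path_distinct)
  \<comment> \<open>Distinct vertices let \<open>p\<close> use the edge only once, so the pieces
    before and after it survive the deletion.\<close>
  have unique: "{p ! k, p ! Suc k} \<noteq> ?e" if "Suc k < length p" "k \<noteq> i" for k
    using that i d by (auto simp: doubleton_eq_iff nth_eq_iff_index_eq)
  have "?e \<in> E" using path(1) i by (simp add: is_path_nth)
  then have "is_bridge V E ?e" using nc by (simp add: is_bridge_def)
  then have "component V (E - {?e}) S = component V (E - {?e}) T"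
    using nsep by (auto simp: separated_by_bridge_def)
  then have ST: "?R S T" using assms(2,3) by (auto simp: component_eq)
  have "is_path V (E - {?e}) (take (Suc i) p)"
    using is_path_take[OF path(1), of "Suc i"] unique i by (auto simp: is_path_nth)
  from path_imp_reachable[OF this] have "?R S (p ! i)"
    using i path by (simp add: last_take_Suc)
  moreover have "is_path V (E - {?e}) (drop (Suc i) p)"
    using is_path_drop[OF path(1), of "Suc i"] unique i by (auto simp: is_path_nth)
  from path_imp_reachable[OF this] have "?R (p ! Suc i) T"
    using i path by (simp add: hd_drop_conv_nth)
  ultimately have detour: "?R (p ! i) (p ! Suc i)"
    using ST by (meson reachable_sym rtranclp_trans)
  have "graph_connected V (E - {?e})"
  proof (rule graph_connected_replace[OF assms(1)])
    fix u v assume uv: "adjacent V E u v"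
    show "?R u v"
    proof (cases "{u, v} = ?e")
      case True
      then show ?thesis using detour reachable_sym[OF detour] by (auto simp: doubleton_eq_iff)
    next
      case False
      then show ?thesis using uv by (intro r_into_rtranclp) (simp add: adjacent_def)
    qed
  qed
  then show False using nc by simp
qed

text \<open>An apex before position \<open>i\<close> would give a shortcut to
  \<open>p ! Suc i\<close>, one after position \<open>Suc i\<close> a shortcut from
  \<open>p ! i\<close>.\<close>

lemma apex_not_on_shortest_path:
  assumes p: "shortest_path V E S T p" and i: "Suc i < length p"
    and w: "{p ! i, w} \<in> E" "{w, p ! Suc i} \<in> E" "w \<noteq> p ! i" "w \<noteq> p ! Suc i"
  shows "w \<notin> set p"
proof
  assume "w \<in> set p"
  then obtain k where k: "k < length p" "w = p ! k" by (metis in_set_conv_nth)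
  then have "k < i \<or> Suc i < k" using w by (metis linorder_neqE_nat not_less_eq)
  then show False
    using shortest_path_no_shortcut[OF p, of k "Suc i"] shortest_path_no_shortcut[OF p, of i k]
      i k w by auto
qed

lemma path_edges_in_set: "e \<in> path_edges p \<Longrightarrow> e \<subseteq> set p"
  by (auto simp: path_edges_def)

lemma shortest_path_nonseparating:
  assumes "chordal_graph V E" and conn: "graph_connected V E" and "S \<in> V" and "T \<in> V"
    and p: "shortest_path V E S T p"
    and "\<not> separated_by_bridge V E S T"
  shows "nonseparating_path V E S T p"
proof -
  let ?F = "E - path_edges p"
  let ?R = "(adjacent V ?F)\<^sup>*\<^sup>*"
  have path: "is_path V E p" "path_between V E S T p"
    using p by (auto simp: shortest_path_def path_between_def)
  have detour: "?R (p ! i) (p ! Suc i)" if i: "Suc i < length p" for i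
  proof -
    let ?u = "p ! i" and ?v = "p ! Suc i"
    have V: "?u \<in> V" "?v \<in> V" and E: "{?u, ?v} \<in> E"
      using path(1) i by (auto simp: is_path_nth subset_iff)
    have "?u \<noteq> ?v" using shortest_path_distinct[OF p] i by (simp add: nth_eq_iff_index_eq)
    obtain q where "path_between V (E - {{?u, ?v}}) ?u ?v q"
      using shortest_path_edge_not_bridge[OF conn assms(3,4) p assms(6) i] V
      by (auto simp: graph_connected_def)
    then obtain w where w: "w \<in> V" "w \<noteq> ?u" "w \<noteq> ?v" "{?u, w} \<in> E" "{w, ?v} \<in> E"
      using chordal_edge_in_triangle[OF assms(1) E \<open>?u \<noteq> ?v\<close>] by blast
    then have "w \<notin> set p" using apex_not_on_shortest_path[OF p i] by blast
    \<comment> \<open>Every edge of \<open>p\<close> has both ends on \<open>p\<close>, and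
      \<open>w\<close> is off it; so both sides at \<open>w\<close> survive the deletion of all path
      edges at once.\<close>
    then have "adjacent V ?F ?u w" "adjacent V ?F w ?v"
      using w V by (auto simp: adjacent_def dest: path_edges_in_set)
    then show ?thesis by (rule rtranclp.rtrancl_into_rtrancl[OF r_into_rtranclp])
  qed
  have "graph_connected V ?F"
  proof (rule graph_connected_replace[OF conn])
    fix u v assume uv: "adjacent V E u v"
    show "?R u v"
    proof (cases "{u, v} \<in> path_edges p")
      case True
      then obtain i where "Suc i < length p" "{u, v} = {p ! i, p ! Suc i}"
        by (auto simp: path_edges_def)
      \<comment> \<open>The edge may be traversed against the direction of \<open>p\<close>, so the
        reversed detour is needed as well.\<close>
      then show ?thesis
        using detour[of i] reachable_sym[OF detour[of i]] by (auto simp: doubleton_eq_iff)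
    next
      case False
      then show ?thesis using uv by (intro r_into_rtranclp) (simp add: adjacent_def)
    qed
  qed
  then show ?thesis using path by (simp add: nonseparating_path_def)
qed

theorem theorem2:
  fixes V :: "'a set" and E :: "'a set set" and S T :: 'a
  assumes "chordal_graph V E"
    and "graph_connected V E"
    and "S \<in> V" and "T \<in> V" and "S \<noteq> T"
  shows "((\<exists>p. nonseparating_path V E S T p) \<longleftrightarrow> \<not> separated_by_bridge V E S T) \<and>
         ((\<exists>p. nonseparating_path V E S T p) \<longrightarrow>
            (\<forall>p. shortest_path V E S T p \<longrightarrow> nonseparating_path V E S T p))"
proof -
  obtain p where "path_between V E S T p" using assms by (auto simp: graph_connected_def)
  then obtain q where "shortest_path V E S T q" by (blast dest: ex_shortest_path)
  \<comment> \<open>The path \<open>q\<close> witnesses existence when no bridge separates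
    \<open>S\<close> and \<open>T\<close>. Conversely, any non-separating path excludes such a
    bridge, and then every shortest path is non-separating.\<close>
  then show ?thesis
    using shortest_path_nonseparating[OF assms(1-4)] nonseparating_imp_not_separated[OF assms(3,4)]
    by blast
qed

end
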